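(* Let $\mu$ be a singular cardinal, $\kappa = \mathrm{cf}(\mu)$ and $\theta < \kappa$ a cardinal. Assume $2^\kappa < \mathrm{cf}(\lambda) \leq \lambda < \mathrm{cf}(\Upsilon) \leq \Upsilon \leq 2^\mu$ and $\mu < \mathrm{cf}(\lambda)$. Suppose $\mu$ is a limit of measurable cardinals, and $\bar{\lambda} = \langle \lambda_\varepsilon : \varepsilon < \kappa \rangle$ is a sequence of measurable cardinals with limit $\mu$ such that $\kappa < \lambda_0$, both $\prod_{\varepsilon < \kappa} \lambda_\varepsilon / J^{\mathrm{bd}}_\kappa$ and $\prod_{\varepsilon < \kappa} \lambda^+_\varepsilon / J^{\mathrm{bd}}_\kappa$ are $\mathrm{cf}(\Upsilon)$-directed, and $2^{\lambda_\varepsilon} = \lambda_\varepsilon^+$ for every $\varepsilon < \kappa$. For every $\varepsilon<\kappa$ let $D_\varepsilon$ be a normal uniform ultrafilter on $\lambda_\varepsilon$, and assume that the product $\prod_{\varepsilon < \kappa} (D_\varepsilon, \subseteq^* ) / J^{\mathrm{bd}}_\kappa$ is $\mathrm{cf}(\Upsilon)$-directed. Then $\binom{\lambda}{\mu} \rightarrow \binom{\lambda}{\mu}^{1,1}_\theta$ holds, i.e., for every coloring $c : \lambda \times \mu \rightarrow \theta$ there are $A \subseteq \lambda$ with $|A| = \lambda$, $B \subseteq \mu$ with $|B| = \mu$, and $i_* < \theta$ such that $c(\alpha,\beta) = i_*$ for all $\alpha \in A$, $\beta \in B$.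
   Context: $J^{\mathrm{bd}}_\kappa$ is the ideal of bounded subsets of the regular cardinal $\kappa$. For functions $f,g$ in a product $\prod_{\varepsilon<\kappa}\lambda_\varepsilon$, $f \leq_{J^{\mathrm{bd}}_\kappa} g$ means $\{\varepsilon<\kappa : f(\varepsilon) > g(\varepsilon)\}$ is bounded in $\kappa$. A product of partial orders modulo $J^{\mathrm{bd}}_\kappa$ is $\chi$-directed if every subset of cardinality less than $\chi$ has an upper bound in the product modulo $J^{\mathrm{bd}}_\kappa$. For $X,Y \subseteq \lambda_\varepsilon$, $X \subseteq^* Y$ means $X \setminus Y$ is bounded in $\lambda_\varepsilon$. In $\prod_{\varepsilon<\kappa}(D_\varepsilon,\subseteq^* )$ the order is reverse almost inclusion: $\bar{C} \leq \bar{C}'$ iff $C'_\varepsilon \subseteq^* C_\varepsilon$; modulo $J^{\mathrm{bd}}_\kappa$ means this holds for all $\varepsilon$ outside a bounded subset of $\kappa$. *)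

theory Defs
  imports Main "HOL-Library.FuncSet"
begin

unbundle cardinal_syntax

text \<open>
  A cardinal is a relation \<open>r\<close> with \<open>Card_order r\<close>, that is, an initial well-order on \<open>Field r\<close>.
  The elements of \<open>Field r\<close> play the role of the ordinals below the cardinal, and the ordinal
  \<open>a\<close>, viewed as the set of its predecessors, is \<open>underS r a\<close>.
\<close>

definition bounded_in :: "'a rel \<Rightarrow> 'a set \<Rightarrow> bool" where
  "bounded_in r A \<longleftrightarrow> (\<exists>a\<in>Field r. A \<subseteq> underS r a)"

definition Jbd :: "'a rel \<Rightarrow> 'a set set" where
  "Jbd r = {A. A \<subseteq> Field r \<and> bounded_in r A}"

text \<open>The least cardinality of an unbounded subset of \<open>r\<close>. The weak inequality makes the
  cofinality of a nonzero finite cardinal equal to 1.\<close>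

definition cofinal_subset :: "'a rel \<Rightarrow> 'a set \<Rightarrow> bool" where
  "cofinal_subset r A \<longleftrightarrow> A \<subseteq> Field r \<and> (\<forall>a\<in>Field r. \<exists>b\<in>A. (a, b) \<in> r)"

definition cf :: "'a rel \<Rightarrow> 'a rel" where
  "cf r = |SOME A. cofinal_subset r A \<and> (\<forall>B. cofinal_subset r B \<longrightarrow> |A| \<le>o |B| )|"

definition singular_cardinal :: "'a rel \<Rightarrow> bool" where
  "singular_cardinal r \<longleftrightarrow> Card_order r \<and> infinite (Field r) \<and> cf r <o r"

definition ultrafilter_on :: "'a set \<Rightarrow> 'a set set \<Rightarrow> bool" where
  "ultrafilter_on S U \<longleftrightarrow>
     U \<subseteq> Pow S \<and> S \<in> U \<and> {} \<notin> U \<and>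
     (\<forall>X\<in>U. \<forall>Y\<in>U. X \<inter> Y \<in> U) \<and>
     (\<forall>X\<in>U. \<forall>Y. X \<subseteq> Y \<and> Y \<subseteq> S \<longrightarrow> Y \<in> U) \<and>
     (\<forall>X. X \<subseteq> S \<longrightarrow> X \<in> U \<or> S - X \<in> U)"

definition nonprincipal_on :: "'a set \<Rightarrow> 'a set set \<Rightarrow> bool" where
  "nonprincipal_on S U \<longleftrightarrow> (\<forall>x\<in>S. {x} \<notin> U)"

definition complete_family :: "'a rel \<Rightarrow> 'a set set \<Rightarrow> bool" where
  "complete_family r U \<longleftrightarrow> (\<forall>F. F \<subseteq> U \<and> F \<noteq> {} \<and> |F| <o r \<longrightarrow> \<Inter>F \<in> U)"

definition measurable_cardinal :: "'a rel \<Rightarrow> bool" where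
  "measurable_cardinal r \<longleftrightarrow> Card_order r \<and> natLeq <o r \<and>
     (\<exists>U. ultrafilter_on (Field r) U \<and> nonprincipal_on (Field r) U \<and> complete_family r U)"

definition diagonal_intersection :: "'a rel \<Rightarrow> ('a \<Rightarrow> 'a set) \<Rightarrow> 'a set" where
  "diagonal_intersection r X = {b \<in> Field r. \<forall>a\<in>underS r b. b \<in> X a}"

text \<open>A normal ultrafilter on \<open>r\<close> is a nonprincipal \<open>r\<close>-complete ultrafilter closed under diagonal
  intersections; it is uniform if all its members have full cardinality.\<close>

definition normal_ultrafilter :: "'a rel \<Rightarrow> 'a set set \<Rightarrow> bool" where
  "normal_ultrafilter r U \<longleftrightarrow>
     ultrafilter_on (Field r) U \<and> nonprincipal_on (Field r) U \<and> complete_family r U \<and>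
     (\<forall>X. (\<forall>a\<in>Field r. X a \<in> U) \<longrightarrow> diagonal_intersection r X \<in> U)"

definition uniform_ultrafilter :: "'a rel \<Rightarrow> 'a set set \<Rightarrow> bool" where
  "uniform_ultrafilter r U \<longleftrightarrow> ultrafilter_on (Field r) U \<and> (\<forall>X\<in>U. |X| =o r)"

definition almost_subset :: "'a rel \<Rightarrow> 'a set \<Rightarrow> 'a set \<Rightarrow> bool" where
  "almost_subset r X Y \<longleftrightarrow> bounded_in r (X - Y)"

text \<open>Every subset of \<open>\<Prod>\<^sub>i\<^sub>\<in>\<^sub>I P i\<close> of cardinality less than \<open>\<chi>\<close> has an upper bound in the product,
  where the \<open>i\<close>-th factor is ordered by \<open>le i\<close> and the product is taken modulo the ideal \<open>J\<close>.\<close>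

definition directed_mod ::
  "'c rel \<Rightarrow> 'i set \<Rightarrow> 'i set set \<Rightarrow> ('i \<Rightarrow> 'a set) \<Rightarrow> ('i \<Rightarrow> 'a \<Rightarrow> 'a \<Rightarrow> bool) \<Rightarrow> bool" where
  "directed_mod \<chi> I J P le \<longleftrightarrow>
     (\<forall>F. F \<subseteq> (\<Pi>\<^sub>E i\<in>I. P i) \<and> |F| <o \<chi> \<longrightarrow>
        (\<exists>g\<in>(\<Pi>\<^sub>E i\<in>I. P i). \<forall>f\<in>F. {i \<in> I. \<not> le i (f i) (g i)} \<in> J))"

definition limit_of_measurables :: "'m rel \<Rightarrow> bool" where
  "limit_of_measurables \<mu> \<longleftrightarrow>
     (\<forall>\<chi> :: 'm rel. Card_order \<chi> \<and> \<chi> <o \<mu> \<longrightarrow>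
        (\<exists>\<nu> :: 'm rel. measurable_cardinal \<nu> \<and> \<chi> <o \<nu> \<and> \<nu> <o \<mu>))"

text \<open>Convergence in the order topology of the \<open>\<kappa>\<close>-sequence of cardinals \<open>L\<close> to \<open>\<mu>\<close>; the sequence
  is not required to be monotone. The cardinals below \<open>\<mu>\<close> are all represented on the type of \<open>\<mu>\<close>.\<close>

definition has_limit :: "'k rel \<Rightarrow> ('k \<Rightarrow> 'a rel) \<Rightarrow> 'm rel \<Rightarrow> bool" where
  "has_limit \<kappa> L \<mu> \<longleftrightarrow>
     (\<forall>\<chi> :: 'm rel. Card_order \<chi> \<and> \<chi> <o \<mu> \<longrightarrow>
        (\<exists>\<delta>\<in>Field \<kappa>. \<forall>\<epsilon>\<in>Field \<kappa>. (\<delta>, \<epsilon>) \<in> \<kappa> \<longrightarrow> \<chi> <o L \<epsilon> \<and> L \<epsilon> \<le>o \<mu>))"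

text \<open>The polarized partition relation with exponent \<open>1,1\<close>: the top row is \<open>a\<close>, \<open>a'\<close> and the
  bottom row \<open>b\<close>, \<open>b'\<close>.\<close>

definition polarized_arrow :: "'a rel \<Rightarrow> 'b rel \<Rightarrow> 'c rel \<Rightarrow> 'd rel \<Rightarrow> 't rel \<Rightarrow> bool" where
  "polarized_arrow a b a' b' \<theta> \<longleftrightarrow>
     (\<forall>c. (\<forall>\<alpha>\<in>Field a. \<forall>\<beta>\<in>Field b. c \<alpha> \<beta> \<in> Field \<theta>) \<longrightarrow>
        (\<exists>A B. \<exists>i\<in>Field \<theta>. A \<subseteq> Field a \<and> B \<subseteq> Field b \<and> |A| =o a' \<and> |B| =o b' \<and>
           (\<forall>\<alpha>\<in>A. \<forall>\<beta>\<in>B. c \<alpha> \<beta> = i)))"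

end

theory Submission
  imports Defs
begin

text \<open>
  For every \<open>\<alpha>\<close> and almost every \<open>\<epsilon>\<close>, completeness of \<open>D \<epsilon>\<close> yields a colour whose class
  in the \<open>\<alpha>\<close>-th row is large. Directedness of \<open>\<Prod>D \<epsilon>\<close>, followed by directedness of
  \<open>\<Prod>L \<epsilon>\<close> applied to the bounds of the exceptional sets, gives a single sequence of large sets
  \<open>W \<epsilon>\<close> such that for every \<open>\<alpha>\<close> the \<open>\<alpha>\<close>-th row is constant on \<open>W \<epsilon>\<close> for almost all
  \<open>\<epsilon>\<close>. Since \<open>\<theta> < cf \<mu>\<close>, some colour is taken on a set of \<open>\<epsilon>\<close> over which the \<open>W \<epsilon>\<close>
  have union of size \<open>\<mu>\<close>. There are at most \<open>2\<^sup>\<kappa>\<close> such sets of \<open>\<epsilon>\<close> and \<open>\<theta>\<close> colours, both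
  below \<open>cf \<lambda>\<close>, so \<open>\<lambda>\<close> many \<open>\<alpha>\<close> share them.
\<close>

section \<open>Cofinality and counting\<close>

text \<open>Cardinals are well-ordered by \<open>\<le>o\<close>, so a cofinal set of least size
  exists and the choice in the definition of \<open>cf\<close> really picks a minimum.\<close>

lemma cf_le_cofinal:
  assumes "Well_order r" and "cofinal_subset r B"
  shows "cf r \<le>o |B|"
proof -
  let ?R = "{ |A| | A. cofinal_subset r A}"
  have "\<exists>p\<in>?R. \<forall>p'\<in>?R. p \<le>o p'"
    by (rule exists_minim_Card_order) (use assms(2) card_of_Card_order in blast)+
  then have "\<exists>A. cofinal_subset r A \<and> (\<forall>B. cofinal_subset r B \<longrightarrow> |A| \<le>o |B| )"
    by blast
  from someI_ex[OF this] assms(2) show ?thesis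
    unfolding cf_def by blast
qed

text \<open>A smaller well-order is isomorphic to a proper initial segment of \<open>r\<close>. This
  trades cardinals below \<open>r\<close> for elements of \<open>r\<close>, to which cofinality
  applies.\<close>

lemma card_le_underS:
  assumes r: "Card_order r" and X: "|X| <o r"
  shows "\<exists>a\<in>Field r. |X| \<le>o |underS r a|"
proof -
  have "Well_order r" "Well_order |X|"
    using r card_of_Well_order by (auto simp: card_order_on_def)
  then obtain a where a: "a \<in> Field r" "|X| =o Restr r (underS r a)"
    using X ordLess_iff_ordIso_Restr by blast
  have "|Field |X|| =o |Field (Restr r (underS r a))|"
    using a(2) by (rule card_of_cong)
  moreover have "|Field (Restr r (underS r a))| \<le>o |underS r a|"
    by (rule card_of_mono1) (auto simp: Field_def)
  ultimately have "|X| \<le>o |underS r a|"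
    by (simp add: Field_card_of ordIso_ordLeq_trans)
  with a(1) show ?thesis by blast
qed

text \<open>The chosen bounds \<open>b s\<close> are too few to be cofinal, so some \<open>a\<close>
  has none of them above it; by totality \<open>a\<close> lies above all of them.\<close>

lemma cf_bounded_family:
  assumes r: "Card_order r" and S: "|S| <o cf r"
    and X: "\<And>s. s \<in> S \<Longrightarrow> |X s| <o r"
  shows "\<exists>a\<in>Field r. \<forall>s\<in>S. |X s| \<le>o |underS r a|"
proof -
  have wo: "Well_order r" using r by (auto simp: card_order_on_def)
  have "\<forall>s\<in>S. \<exists>a\<in>Field r. |X s| \<le>o |underS r a|"
    using card_le_underS[OF r] X by blast
  then obtain b where b: "\<And>s. s \<in> S \<Longrightarrow> b s \<in> Field r"
      "\<And>s. s \<in> S \<Longrightarrow> |X s| \<le>o |underS r (b s)|"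
    by metis
  have "\<not> cofinal_subset r (b ` S)"
  proof
    assume "cofinal_subset r (b ` S)"
    then have "cf r \<le>o |b ` S|" by (rule cf_le_cofinal[OF wo])
    then have "cf r \<le>o |S|" using card_of_image ordLeq_transitive by blast
    with S show False using not_ordLess_ordLeq by blast
  qed
  then obtain a where a: "a \<in> Field r" "\<And>s. s \<in> S \<Longrightarrow> (a, b s) \<notin> r"
    unfolding cofinal_subset_def using b(1) by auto
  have "|X s| \<le>o |underS r a|" if "s \<in> S" for s
  proof -
    have "(b s, a) \<in> r"
      using a b(1) that wo wo_rel.TOTALS[of r] unfolding wo_rel_def by blast
    then have "underS r (b s) \<subseteq> underS r a"
      using wo underS_incr[of r] by (simp add: order_on_defs)
    then show ?thesis
      using b(2)[OF that] card_of_mono1 ordLeq_transitive by blast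
  qed
  with a(1) show ?thesis by blast
qed

lemma card_Times_ordLess:
  assumes r: "Card_order r" and inf: "infinite (Field r)"
    and A: "|A| <o r" and B: "|B| <o r"
  shows "|A \<times> B| <o r"
proof -
  \<comment> \<open>The second factor is taken to dominate the first; totality and commutativity
    then reduce the general case to this one.\<close>
  have le: "|X \<times> Y| <o r" if XY: "|X| \<le>o |Y|" and Y: "|Y| <o r"
    for X :: "'x set" and Y :: "'y set"
  proof (cases "finite Y")
    case True
    then have "finite (X \<times> Y)" using XY card_of_ordLeq_finite by blast
    then have "|X \<times> Y| <o |Field r|" using inf
      by (intro finite_ordLess_infinite card_of_Well_order) (simp_all add: Field_card_of)
    then show ?thesis using card_of_Field_ordIso[OF r] ordLess_ordIso_trans by blast
  next
    case False
    have "|X \<times> Y| \<le>o |Y|"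
      by (rule card_of_Times_ordLeq_infinite_Field)
         (use False XY card_of_Card_order[of Y] ordIso_imp_ordLeq[OF card_of_refl] in \<open>simp_all add: Field_card_of\<close>)
    then show ?thesis using Y by (rule ordLeq_ordLess_trans)
  qed
  have "|A| \<le>o |B| \<or> |B| \<le>o |A|" by (rule ordLeq_total) (rule card_of_Well_order)+
  then show ?thesis
    using le[OF _ A] le[OF _ B] card_of_Times_commute ordIso_ordLess_trans by blast
qed

text \<open>If all fibres were smaller than \<open>r\<close>, \<open>cf_bounded_family\<close> would
  give them a common bound \<open>|underS r a|\<close>, and \<open>A\<close> would be no larger than
  \<open>S \<times> underS r a\<close>, a product of two sets smaller than \<open>r\<close>. The
  argument covers singular \<open>r\<close>.\<close>

lemma cf_pigeonhole:
  assumes r: "Card_order r" and inf: "infinite (Field r)" and cf: "cf r \<le>o r"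
    and A: "A \<subseteq> Field r" "|A| =o r"
    and f: "f ` A \<subseteq> S" and S: "|S| <o cf r"
  shows "\<exists>s\<in>S. |{x \<in> A. f x = s}| =o r"
proof (rule ccontr)
  assume no: "\<not> ?thesis"
  have "|{x \<in> A. f x = s}| <o r" if "s \<in> S" for s
  proof -
    have "|{x \<in> A. f x = s}| \<le>o |A|" by (rule card_of_mono1) auto
    then have "|{x \<in> A. f x = s}| \<le>o r" using A(2) ordLeq_ordIso_trans by blast
    with no that show ?thesis using ordLeq_iff_ordLess_or_ordIso by blast
  qed
  from cf_bounded_family[where X = "\<lambda>s. {x \<in> A. f x = s}", OF r S this] obtain a where a: "a \<in> Field r"
    "\<forall>s\<in>S. |{x \<in> A. f x = s}| \<le>o |underS r a|" by blast
  have "|\<Union>s\<in>S. {x \<in> A. f x = s}| \<le>o |S \<times> underS r a|"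
    using card_of_UNION_Sigma[of "\<lambda>s. {x \<in> A. f x = s}" S]
      card_of_Sigma_mono1[OF a(2)] ordLeq_transitive by blast
  moreover have "(\<Union>s\<in>S. {x \<in> A. f x = s}) = A" using f by blast
  moreover have "|S \<times> underS r a| <o r"
    using card_Times_ordLess[OF r inf] card_of_underS[OF r a(1)]
      ordLess_ordLeq_trans[OF S cf] by blast
  ultimately have "|A| <o r" using ordLeq_ordLess_trans by metis
  with A(2) show False using not_ordLess_ordIso by blast
qed

section \<open>Complete and uniform ultrafilters\<close>

text \<open>Otherwise the complements of the colour classes would be fewer than \<open>r\<close>
  members of \<open>U\<close> with empty intersection.\<close>

lemma ultrafilter_colour:
  assumes U: "ultrafilter_on (Field r) U" "complete_family r U"
    and T: "|T| <o r" and f: "f ` Field r \<subseteq> T"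
  shows "\<exists>i\<in>T. {x \<in> Field r. f x = i} \<in> U"
proof (rule ccontr)
  assume no: "\<not> ?thesis"
  let ?F = "(\<lambda>i. Field r - {x \<in> Field r. f x = i}) ` T"
  \<comment> \<open>\<open>complete_family\<close> speaks of nonempty families only, so some colour
    must occur.\<close>
  have "Field r \<noteq> {}" using U(1) unfolding ultrafilter_on_def by metis
  then have "?F \<noteq> {}" using f by blast
  moreover have "?F \<subseteq> U"
  proof
    fix Y assume "Y \<in> ?F"
    then obtain i where i: "i \<in> T" "Y = Field r - {x \<in> Field r. f x = i}" by blast
    have "\<And>Z. Z \<subseteq> Field r \<Longrightarrow> Z \<in> U \<or> Field r - Z \<in> U"
      using U(1) unfolding ultrafilter_on_def by simp
    from this[of "{x \<in> Field r. f x = i}"] show "Y \<in> U" using i no by auto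
  qed
  moreover have "|?F| <o r" using card_of_image T ordLeq_ordLess_trans by blast
  ultimately have "\<Inter>?F \<in> U" using U(2) unfolding complete_family_def by blast
  moreover have "\<Inter>?F = {}" using \<open>?F \<noteq> {}\<close> f by blast
  ultimately show False using U(1) unfolding ultrafilter_on_def by simp
qed

text \<open>A proper initial segment of a cardinal is too small to belong to a uniform ultrafilter.
  Thus bounded exceptional sets can be cut off.\<close>

lemma uniform_ultrafilter_Diff_underS:
  assumes r: "Card_order r" and U: "uniform_ultrafilter r U"
    and X: "X \<in> U" and a: "a \<in> Field r"
  shows "X - underS r a \<in> U"
proof -
  have uf: "ultrafilter_on (Field r) U" using U unfolding uniform_ultrafilter_def by blast
  have "|underS r a| <o r" using card_of_underS[OF r a] .
  then have "underS r a \<notin> U"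
    using U not_ordLess_ordIso unfolding uniform_ultrafilter_def by blast
  moreover have "underS r a \<subseteq> Field r" unfolding underS_def Field_def by blast
  ultimately have "Field r - underS r a \<in> U" using uf unfolding ultrafilter_on_def by blast
  then have "X \<inter> (Field r - underS r a) \<in> U" using uf X unfolding ultrafilter_on_def by blast
  moreover have "X \<inter> (Field r - underS r a) = X - underS r a"
    using uf X unfolding ultrafilter_on_def by blast
  ultimately show ?thesis by simp
qed

section \<open>Properties of almost all indices\<close>

text \<open>The filter dual to \<open>Jbd r\<close>, stated positively so that finitely many
  conditions can be met at one index.\<close>

definition tail :: "'a rel \<Rightarrow> ('a \<Rightarrow> bool) \<Rightarrow> bool" where
  "tail r P \<longleftrightarrow> (\<exists>a\<in>Field r. \<forall>b\<in>Field r. (a, b) \<in> r \<longrightarrow> P b)"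

lemma tail_conj:
  assumes r: "Well_order r" and "tail r P" and "tail r Q"
  shows "tail r (\<lambda>b. P b \<and> Q b)"
proof -
  have tr: "trans r" and tot: "\<And>a b. a \<in> Field r \<Longrightarrow> b \<in> Field r \<Longrightarrow> (a, b) \<in> r \<or> (b, a) \<in> r"
    using r wo_rel.TOTALS[of r] wo_rel.TRANS[of r] unfolding wo_rel_def by blast+
  obtain a a' where a: "a \<in> Field r" "a' \<in> Field r"
    "\<forall>b\<in>Field r. (a, b) \<in> r \<longrightarrow> P b" "\<forall>b\<in>Field r. (a', b) \<in> r \<longrightarrow> Q b"
    using assms unfolding tail_def by blast
  then show ?thesis
    using tot[OF a(1,2)] tr unfolding tail_def trans_def by meson
qed

lemma tail_ex:
  assumes "Well_order r" and "tail r P"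
  shows "\<exists>b\<in>Field r. P b"
  using assms wo_rel.REFL[of r] unfolding tail_def wo_rel_def refl_on_def by blast

lemma tail_mono:
  assumes "tail r P" and "\<And>b. b \<in> Field r \<Longrightarrow> P b \<Longrightarrow> Q b"
  shows "tail r Q"
  using assms unfolding tail_def by blast

lemma tail_of_Jbd:
  assumes r: "Well_order r" and "{b \<in> Field r. \<not> P b} \<in> Jbd r"
  shows "tail r P"
proof -
  obtain a where a: "a \<in> Field r" "{b \<in> Field r. \<not> P b} \<subseteq> underS r a"
    using assms(2) unfolding Jbd_def bounded_in_def by blast
  \<comment> \<open>\<open>underS\<close> is strict, so the bound \<open>a\<close> itself already
    belongs to the tail.\<close>
  have "P b" if "b \<in> Field r" "(a, b) \<in> r" for b
  proof (rule ccontr)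
    assume "\<not> P b"
    then have "b \<noteq> a" "(b, a) \<in> r" using a that unfolding underS_def by blast+
    then show False
      using that(2) r wo_rel.ANTISYM[of r] unfolding wo_rel_def antisym_def by blast
  qed
  with a(1) show ?thesis unfolding tail_def by blast
qed

text \<open>Passes from sets of extensional functions to indexed families: restricting to
  \<open>Field k\<close> changes no value that \<open>tail\<close> sees, and the image of
  \<open>A\<close> is no larger than \<open>A\<close>.\<close>

lemma directed_mod_bound:
  assumes dir: "directed_mod \<chi> (Field k) (Jbd k) P le" and k: "Well_order k"
    and A: "|A| <o \<chi>" and F: "\<And>x e. x \<in> A \<Longrightarrow> e \<in> Field k \<Longrightarrow> F x e \<in> P e"
  shows "\<exists>g. (\<forall>e\<in>Field k. g e \<in> P e) \<and> (\<forall>x\<in>A. tail k (\<lambda>e. le e (F x e) (g e)))"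
proof -
  let ?F = "(\<lambda>x. restrict (F x) (Field k)) ` A"
  have "?F \<subseteq> (\<Pi>\<^sub>E e\<in>Field k. P e)" using F by auto
  moreover have "|?F| <o \<chi>" using card_of_image A ordLeq_ordLess_trans by blast
  ultimately obtain g where g: "g \<in> (\<Pi>\<^sub>E e\<in>Field k. P e)"
    "\<forall>f\<in>?F. {e \<in> Field k. \<not> le e (f e) (g e)} \<in> Jbd k"
    using dir unfolding directed_mod_def by blast
  have "tail k (\<lambda>e. le e (F x e) (g e))" if "x \<in> A" for x
  proof -
    have "tail k (\<lambda>e. le e (restrict (F x) (Field k) e) (g e))"
      by (rule tail_of_Jbd[OF k]) (use g(2) that in blast)
    then show ?thesis by (rule tail_mono) simp
  qed
  with g(1) show ?thesis by (intro exI[of _ g]) auto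
qed

theorem theorem2p1:
  fixes \<mu> :: "'m rel" and \<kappa> :: "'k rel" and \<theta> :: "'t rel"
    and lam :: "'l rel" and \<Upsilon> :: "'u rel"
    and L :: "'k \<Rightarrow> 'a rel" and D :: "'k \<Rightarrow> 'a set set"
  assumes "singular_cardinal \<mu>"
    and "Card_order \<kappa>" and "\<kappa> =o cf \<mu>"
    and "Card_order \<theta>" and "\<theta> <o \<kappa>"
    and "Card_order lam" and "Card_order \<Upsilon>"
    and "ctwo ^c \<kappa> <o cf lam" and "cf lam \<le>o lam"
    and "lam <o cf \<Upsilon>" and "cf \<Upsilon> \<le>o \<Upsilon>" and "\<Upsilon> \<le>o ctwo ^c \<mu>"
    and "\<mu> <o cf lam"
    and "limit_of_measurables \<mu>"
    and "\<forall>\<epsilon>\<in>Field \<kappa>. measurable_cardinal (L \<epsilon>)"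
    and "has_limit \<kappa> L \<mu>"
    and "\<kappa> <o L (wo_rel.minim \<kappa> (Field \<kappa>))"
    and "directed_mod (cf \<Upsilon>) (Field \<kappa>) (Jbd \<kappa>)
           (\<lambda>\<epsilon>. Field (L \<epsilon>)) (\<lambda>\<epsilon> x y. (x, y) \<in> L \<epsilon>)"
    and "directed_mod (cf \<Upsilon>) (Field \<kappa>) (Jbd \<kappa>)
           (\<lambda>\<epsilon>. Field (cardSuc (L \<epsilon>))) (\<lambda>\<epsilon> x y. (x, y) \<in> cardSuc (L \<epsilon>))"
    and "\<forall>\<epsilon>\<in>Field \<kappa>. ctwo ^c L \<epsilon> =o cardSuc (L \<epsilon>)"
    and "\<forall>\<epsilon>\<in>Field \<kappa>. normal_ultrafilter (L \<epsilon>) (D \<epsilon>) \<and> uniform_ultrafilter (L \<epsilon>) (D \<epsilon>)"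
    and "directed_mod (cf \<Upsilon>) (Field \<kappa>) (Jbd \<kappa>) D (\<lambda>\<epsilon> X Y. almost_subset (L \<epsilon>) Y X)"
  shows "polarized_arrow lam \<mu> lam \<mu> \<theta>"
proof -
  note mu = assms(1) and \<kappa> = assms(2) and \<kappa>cf = assms(3) and \<theta> = assms(4) and \<theta>\<kappa> = assms(5)
    and lam = assms(6) and pow = assms(8) and cflam = assms(9) and lam\<Upsilon> = assms(10)
    and \<mu>lam = assms(13) and Lmeas = assms(15) and lim = assms(16)
    and dirL = assms(18) and D = assms(21) and dirD = assms(22)
  have \<mu>: "Card_order \<mu>" "infinite (Field \<mu>)" "cf \<mu> <o \<mu>"
    using mu unfolding singular_cardinal_def by auto
  have wo\<kappa>: "Well_order \<kappa>" using \<kappa> by (auto simp: card_order_on_def)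
  have LC: "Card_order (L \<epsilon>)" if "\<epsilon> \<in> Field \<kappa>" for \<epsilon>
    using Lmeas that unfolding measurable_cardinal_def by blast
  have LD: "ultrafilter_on (Field (L \<epsilon>)) (D \<epsilon>)" "complete_family (L \<epsilon>) (D \<epsilon>)"
    "uniform_ultrafilter (L \<epsilon>) (D \<epsilon>)" if "\<epsilon> \<in> Field \<kappa>" for \<epsilon>
    using D that unfolding normal_ultrafilter_def by blast+
  have tl: "tail \<kappa> (\<lambda>\<epsilon>. \<chi> <o L \<epsilon> \<and> L \<epsilon> \<le>o \<mu>)" if "Card_order \<chi>" "\<chi> <o \<mu>" for \<chi> :: "'m rel"
    using lim that unfolding has_limit_def tail_def by blast
  have inflam: "infinite (Field lam)"
  proof -
    have "\<mu> \<le>o lam"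
      using ordLess_imp_ordLeq[OF \<mu>lam] cflam by (rule ordLeq_transitive)
    then show ?thesis using \<mu>(2) card_of_ordLeq_infinite card_of_mono2 by blast
  qed
  have cardlam: "|Field lam| <o cf \<Upsilon>"
    using card_of_Field_ordIso[OF lam] lam\<Upsilon> ordIso_ordLess_trans by blast
  have card\<theta>: "|Field \<theta>| =o \<theta>" using card_of_Field_ordIso[OF \<theta>] .
  have \<theta>cf: "|Field \<theta>| <o cf \<mu>"
    using card\<theta> \<theta>\<kappa> \<kappa>cf ordIso_ordLess_trans ordLess_ordIso_trans by blast
  have pow': "|Pow (Field \<kappa>)| <o cf lam"
  proof -
    have "|Pow (Field \<kappa>)| =o ctwo ^c \<kappa>"
      unfolding cexp_def ctwo_def Field_card_of by (rule card_of_Pow_Func)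
    then show ?thesis using pow ordIso_ordLess_trans by blast
  qed
  have \<theta>lam: "|Field \<theta>| <o cf lam"
  proof -
    have "|Field \<theta>| <o \<kappa>" using card\<theta> \<theta>\<kappa> ordIso_ordLess_trans by blast
    moreover have "\<kappa> =o |Field \<kappa>|" using \<kappa> by (rule ordIso_symmetric[OF card_of_Field_ordIso])
    moreover have "|Field \<kappa>| <o |Pow (Field \<kappa>)|" by (rule card_of_Pow)
    ultimately have "|Field \<theta>| <o |Pow (Field \<kappa>)|"
      using ordLess_ordIso_trans ordLess_transitive by blast
    then show ?thesis using pow' ordLess_transitive by blast
  qed

  show ?thesis
    unfolding polarized_arrow_def
  proof (intro allI impI)
    fix c :: "'l \<Rightarrow> 'm \<Rightarrow> 't"
    assume c: "\<forall>\<alpha>\<in>Field lam. \<forall>\<beta>\<in>Field \<mu>. c \<alpha> \<beta> \<in> Field \<theta>"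
    \<comment> \<open>\<open>L \<epsilon>\<close> and \<open>\<mu>\<close> live on different types,
      so \<open>h \<epsilon>\<close> embeds the ordinals below \<open>L \<epsilon>\<close> into
      those below \<open>\<mu>\<close>.\<close>
    have "\<forall>\<epsilon>. \<exists>h. L \<epsilon> \<le>o \<mu> \<longrightarrow> inj_on h (Field (L \<epsilon>)) \<and> h ` Field (L \<epsilon>) \<subseteq> Field \<mu>"
      using card_of_mono2 card_of_ordLeq by metis
    then obtain h where h: "\<And>\<epsilon>. L \<epsilon> \<le>o \<mu> \<Longrightarrow> inj_on (h \<epsilon>) (Field (L \<epsilon>))"
      "\<And>\<epsilon>. L \<epsilon> \<le>o \<mu> \<Longrightarrow> h \<epsilon> ` Field (L \<epsilon>) \<subseteq> Field \<mu>" by metis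
    \<comment> \<open>On \<open>E\<close>, completeness of \<open>D \<epsilon>\<close> handles
      \<open>\<theta>\<close> colours and \<open>h \<epsilon>\<close> is injective. The threshold is
      \<open>cf \<mu>\<close>, which exceeds \<open>\<theta>\<close> and, unlike
      \<open>\<theta>\<close>, lives on the type of \<open>\<mu>\<close>, as
      \<open>has_limit\<close> demands.\<close>
    define E where "E \<epsilon> \<longleftrightarrow> cf \<mu> <o L \<epsilon> \<and> L \<epsilon> \<le>o \<mu>" for \<epsilon>
    have tE: "tail \<kappa> E"
      using tl[OF _ \<mu>(3)] unfolding E_def cf_def by (simp add: card_of_Card_order)

    \<comment> \<open>Outside \<open>E\<close> the whole field serves as a default, so that every
      row yields an element of the full product of the \<open>D \<epsilon>\<close>.\<close>
    have "\<exists>i X. X \<in> D \<epsilon> \<and> (E \<epsilon> \<longrightarrow> i \<in> Field \<theta> \<and> (\<forall>x\<in>X. c \<alpha> (h \<epsilon> x) = i))"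
      if "\<alpha> \<in> Field lam" "\<epsilon> \<in> Field \<kappa>" for \<alpha> \<epsilon>
    proof (cases "E \<epsilon>")
      case True
      have "|Field \<theta>| <o L \<epsilon>" using \<theta>cf True ordLess_transitive unfolding E_def by blast
      moreover have "(\<lambda>x. c \<alpha> (h \<epsilon> x)) ` Field (L \<epsilon>) \<subseteq> Field \<theta>"
        using h(2) True c that(1) unfolding E_def by blast
      ultimately show ?thesis using ultrafilter_colour[OF LD(1,2)[OF that(2)]] by blast
    next
      case False
      moreover have "Field (L \<epsilon>) \<in> D \<epsilon>"
        using LD(1)[OF that(2)] by (simp add: ultrafilter_on_def)
      ultimately show ?thesis by blast
    qed
    then obtain col X where X: "\<And>\<alpha> \<epsilon>. \<alpha> \<in> Field lam \<Longrightarrow> \<epsilon> \<in> Field \<kappa> \<Longrightarrow> X \<alpha> \<epsilon> \<in> D \<epsilon>"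
      and col: "\<And>\<alpha> \<epsilon>. \<alpha> \<in> Field lam \<Longrightarrow> \<epsilon> \<in> Field \<kappa> \<Longrightarrow> E \<epsilon> \<Longrightarrow> col \<alpha> \<epsilon> \<in> Field \<theta>"
        "\<And>\<alpha> \<epsilon> x. \<alpha> \<in> Field lam \<Longrightarrow> \<epsilon> \<in> Field \<kappa> \<Longrightarrow> E \<epsilon> \<Longrightarrow> x \<in> X \<alpha> \<epsilon> \<Longrightarrow> c \<alpha> (h \<epsilon> x) = col \<alpha> \<epsilon>"
      by metis
    \<comment> \<open>The order is reverse almost inclusion, so an upper bound of the rows is almost
      contained in each of them at almost all indices.\<close>
    obtain C where C: "\<And>\<epsilon>. \<epsilon> \<in> Field \<kappa> \<Longrightarrow> C \<epsilon> \<in> D \<epsilon>"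
      "\<And>\<alpha>. \<alpha> \<in> Field lam \<Longrightarrow> tail \<kappa> (\<lambda>\<epsilon>. almost_subset (L \<epsilon>) (C \<epsilon>) (X \<alpha> \<epsilon>))"
      using directed_mod_bound[OF dirD wo\<kappa> cardlam, of X] X by blast
    \<comment> \<open>Where almost inclusion fails, any field element will do; this keeps
      \<open>b \<alpha>\<close> in the product of the fields.\<close>
    have ex_b: "\<exists>a. a \<in> Field (L \<epsilon>) \<and>
        (almost_subset (L \<epsilon>) (C \<epsilon>) (X \<alpha> \<epsilon>) \<longrightarrow> C \<epsilon> - X \<alpha> \<epsilon> \<subseteq> underS (L \<epsilon>) a)"
      if "\<epsilon> \<in> Field \<kappa>" for \<alpha> \<epsilon>
    proof -
      have "Field (L \<epsilon>) \<noteq> {}" using LD(1)[OF that] by (auto simp: ultrafilter_on_def)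
      then show ?thesis unfolding almost_subset_def bounded_in_def by blast
    qed
    define b where "b \<alpha> \<epsilon> = (SOME a. a \<in> Field (L \<epsilon>) \<and>
        (almost_subset (L \<epsilon>) (C \<epsilon>) (X \<alpha> \<epsilon>) \<longrightarrow> C \<epsilon> - X \<alpha> \<epsilon> \<subseteq> underS (L \<epsilon>) a))" for \<alpha> \<epsilon>
    have b: "\<And>\<alpha> \<epsilon>. \<epsilon> \<in> Field \<kappa> \<Longrightarrow> b \<alpha> \<epsilon> \<in> Field (L \<epsilon>)"
      "\<And>\<alpha> \<epsilon>. \<epsilon> \<in> Field \<kappa> \<Longrightarrow> almost_subset (L \<epsilon>) (C \<epsilon>) (X \<alpha> \<epsilon>) \<Longrightarrow> C \<epsilon> - X \<alpha> \<epsilon> \<subseteq> underS (L \<epsilon>) (b \<alpha> \<epsilon>)"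
      using someI_ex[OF ex_b] unfolding b_def by blast+
    obtain g where g: "\<And>\<epsilon>. \<epsilon> \<in> Field \<kappa> \<Longrightarrow> g \<epsilon> \<in> Field (L \<epsilon>)"
      "\<And>\<alpha>. \<alpha> \<in> Field lam \<Longrightarrow> tail \<kappa> (\<lambda>\<epsilon>. (b \<alpha> \<epsilon>, g \<epsilon>) \<in> L \<epsilon>)"
      using directed_mod_bound[OF dirL wo\<kappa> cardlam, of b] b(1) by blast
    \<comment> \<open>Cutting below \<open>g \<epsilon>\<close> removes
      \<open>C \<epsilon> - X \<alpha> \<epsilon>\<close> whenever
      \<open>b \<alpha> \<epsilon>\<close> bounds it and lies below \<open>g \<epsilon>\<close>:
      almost inclusion becomes inclusion.\<close>
    define W where "W \<epsilon> = C \<epsilon> - underS (L \<epsilon>) (g \<epsilon>)" for \<epsilon>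
    have WD: "W \<epsilon> \<in> D \<epsilon>" if "\<epsilon> \<in> Field \<kappa>" for \<epsilon>
      unfolding W_def
      using uniform_ultrafilter_Diff_underS[OF LC[OF that] LD(3)[OF that] C(1)[OF that] g(1)[OF that]] .
    have Wcard: "|W \<epsilon>| =o L \<epsilon>" if "\<epsilon> \<in> Field \<kappa>" for \<epsilon>
      using LD(3)[OF that] WD[OF that] unfolding uniform_ultrafilter_def by blast
    have WField: "W \<epsilon> \<subseteq> Field (L \<epsilon>)" if "\<epsilon> \<in> Field \<kappa>" for \<epsilon>
      using LD(1)[OF that] WD[OF that] by (auto simp: ultrafilter_on_def)
    have tW: "tail \<kappa> (\<lambda>\<epsilon>. W \<epsilon> \<subseteq> X \<alpha> \<epsilon>)" if \<alpha>: "\<alpha> \<in> Field lam" for \<alpha>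
    proof (rule tail_mono[OF tail_conj[OF wo\<kappa> C(2)[OF \<alpha>] g(2)[OF \<alpha>]]])
      fix \<epsilon> assume \<epsilon>: "\<epsilon> \<in> Field \<kappa>"
        and *: "almost_subset (L \<epsilon>) (C \<epsilon>) (X \<alpha> \<epsilon>) \<and> (b \<alpha> \<epsilon>, g \<epsilon>) \<in> L \<epsilon>"
      have "Well_order (L \<epsilon>)" using LC[OF \<epsilon>] by (auto simp: card_order_on_def)
      then have "underS (L \<epsilon>) (b \<alpha> \<epsilon>) \<subseteq> underS (L \<epsilon>) (g \<epsilon>)"
        using underS_incr[of "L \<epsilon>"] * by (simp add: order_on_defs)
      then show "W \<epsilon> \<subseteq> X \<alpha> \<epsilon>" using b(2)[OF \<epsilon>] * unfolding W_def by blast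
    qed

    define S where "S \<alpha> i = {\<epsilon> \<in> Field \<kappa>. E \<epsilon> \<and> W \<epsilon> \<subseteq> X \<alpha> \<epsilon> \<and> col \<alpha> \<epsilon> = i}" for \<alpha> i
    \<comment> \<open>\<open>B\<close> depends on the index set alone, so rows with the same index
      set share the same bottom set.\<close>
    define B where "B Z = (\<Union>\<epsilon>\<in>Z. h \<epsilon> ` W \<epsilon>)" for Z
    have BS: "B (S \<alpha> i) \<subseteq> Field \<mu>" for \<alpha> i
      using h(2) WField unfolding B_def S_def E_def by blast
    \<comment> \<open>Otherwise these fewer than \<open>cf \<mu>\<close> sets would have a common
      bound \<open>|underS \<mu> a|\<close> below \<open>\<mu>\<close>.\<close>
    have "\<exists>i\<in>Field \<theta>. |B (S \<alpha> i)| =o \<mu>" if \<alpha>: "\<alpha> \<in> Field lam" for \<alpha>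
    proof (rule ccontr)
      assume no: "\<not> ?thesis"
      have "|B (S \<alpha> i)| <o \<mu>" if "i \<in> Field \<theta>" for i
      proof -
        have "|B (S \<alpha> i)| \<le>o \<mu>"
          using card_of_mono1[OF BS] card_of_Field_ordIso[OF \<mu>(1)] ordLeq_ordIso_trans by blast
        with no that show ?thesis using ordLeq_iff_ordLess_or_ordIso by blast
      qed
      from cf_bounded_family[where X = "\<lambda>i. B (S \<alpha> i)", OF \<mu>(1) \<theta>cf this] obtain a where a: "a \<in> Field \<mu>"
        "\<forall>i\<in>Field \<theta>. |B (S \<alpha> i)| \<le>o |underS \<mu> a|" by blast
      \<comment> \<open>A late index has \<open>L \<epsilon>\<close> above this bound, yet the copy
        of \<open>W \<epsilon>\<close>, of size \<open>L \<epsilon>\<close>, lies in the set of its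
        own colour.\<close>
      have "|underS \<mu> a| <o \<mu>" using card_of_underS[OF \<mu>(1) a(1)] .
      from tl[OF card_of_Card_order this]
      have "tail \<kappa> (\<lambda>\<epsilon>. ( |underS \<mu> a| <o L \<epsilon> \<and> L \<epsilon> \<le>o \<mu>) \<and> (E \<epsilon> \<and> W \<epsilon> \<subseteq> X \<alpha> \<epsilon>))"
        using tail_conj[OF wo\<kappa> _ tail_conj[OF wo\<kappa> tE tW[OF \<alpha>]]] by blast
      then obtain \<epsilon> where \<epsilon>: "\<epsilon> \<in> Field \<kappa>" "|underS \<mu> a| <o L \<epsilon>" "L \<epsilon> \<le>o \<mu>" "E \<epsilon>" "W \<epsilon> \<subseteq> X \<alpha> \<epsilon>"
        using tail_ex[OF wo\<kappa>] by blast
      have "h \<epsilon> ` W \<epsilon> \<subseteq> B (S \<alpha> (col \<alpha> \<epsilon>))" using \<epsilon> unfolding B_def S_def by blast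
      moreover have "inj_on (h \<epsilon>) (W \<epsilon>)"
        using h(1)[OF \<epsilon>(3)] WField[OF \<epsilon>(1)] inj_on_subset by blast
      ultimately have "|W \<epsilon>| \<le>o |B (S \<alpha> (col \<alpha> \<epsilon>))|" using card_of_ordLeq by blast
      also have "|B (S \<alpha> (col \<alpha> \<epsilon>))| \<le>o |underS \<mu> a|" using a(2) col(1)[OF \<alpha> \<epsilon>(1,4)] by blast
      finally have "|W \<epsilon>| <o L \<epsilon>" using \<epsilon>(2) ordLeq_ordLess_trans by blast
      with Wcard[OF \<epsilon>(1)] show False using not_ordLess_ordIso by blast
    qed
    then obtain i where i: "\<And>\<alpha>. \<alpha> \<in> Field lam \<Longrightarrow> i \<alpha> \<in> Field \<theta>"
      "\<And>\<alpha>. \<alpha> \<in> Field lam \<Longrightarrow> |B (S \<alpha> (i \<alpha>))| =o \<mu>" by metis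
    have "(\<lambda>\<alpha>. S \<alpha> (i \<alpha>)) ` Field lam \<subseteq> Pow (Field \<kappa>)" unfolding S_def by blast
    \<comment> \<open>Two rounds of pigeonhole: first the index set is fixed, then the
      colour.\<close>
    from cf_pigeonhole[OF lam inflam cflam order_refl card_of_Field_ordIso[OF lam] this pow']
    obtain Z where Z: "|{\<alpha> \<in> Field lam. S \<alpha> (i \<alpha>) = Z}| =o lam" by blast
    define A1 where "A1 = {\<alpha> \<in> Field lam. S \<alpha> (i \<alpha>) = Z}"
    have A1: "A1 \<subseteq> Field lam" "|A1| =o lam" "i ` A1 \<subseteq> Field \<theta>"
      using Z i(1) unfolding A1_def by auto
    from cf_pigeonhole[OF lam inflam cflam A1 \<theta>lam]
    obtain j where j: "j \<in> Field \<theta>" "|{\<alpha> \<in> A1. i \<alpha> = j}| =o lam" by blast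
    define A where "A = {\<alpha> \<in> A1. i \<alpha> = j}"
    have "|A| =o |Field lam|"
      using j(2) ordIso_symmetric[OF card_of_Field_ordIso[OF lam]] ordIso_transitive
      unfolding A_def by blast
    then have "infinite A" using inflam card_of_ordIso_finite by blast
    then have "A \<noteq> {}" by auto
    have Sj: "S \<alpha> j = Z" "\<alpha> \<in> Field lam" "i \<alpha> = j" if "\<alpha> \<in> A" for \<alpha>
      using that unfolding A_def A1_def by auto
    \<comment> \<open>One row in \<open>A\<close> is needed to transfer the size of its bottom set
      to \<open>B Z\<close>.\<close>
    obtain \<alpha>0 where \<alpha>0: "\<alpha>0 \<in> A" using \<open>A \<noteq> {}\<close> by blast
    have "B Z \<subseteq> Field \<mu>" "|B Z| =o \<mu>"
      using BS[of \<alpha>0 j] i(2)[of \<alpha>0] Sj[OF \<alpha>0] by auto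
    moreover have "c \<alpha> \<beta> = j" if \<alpha>\<beta>: "\<alpha> \<in> A" "\<beta> \<in> B Z" for \<alpha> \<beta>
    proof -
      obtain \<epsilon> x where "\<epsilon> \<in> S \<alpha> j" "x \<in> W \<epsilon>" "\<beta> = h \<epsilon> x"
        using \<alpha>\<beta>(2) Sj(1)[OF \<alpha>\<beta>(1)] unfolding B_def by blast
      then show ?thesis using col(2)[OF Sj(2)[OF \<alpha>\<beta>(1)]] unfolding S_def by blast
    qed
    moreover have "A \<subseteq> Field lam" "|A| =o lam" using Sj(2) j(2) unfolding A_def by auto
    ultimately show "\<exists>A B. \<exists>i\<in>Field \<theta>. A \<subseteq> Field lam \<and> B \<subseteq> Field \<mu> \<and> |A| =o lam \<and> |B| =o \<mu> \<and>
        (\<forall>\<alpha>\<in>A. \<forall>\<beta>\<in>B. c \<alpha> \<beta> = i)"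
      using j(1) by (intro exI[of _ A] exI[of _ "B Z"] bexI[of _ j] conjI ballI)
  qed
qed

end
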